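(* Let $\lambda$ be a positive real number and let $f(z)=z+\sum_{k=2}^{\infty}a_kz^k$ be a function in the class $\mathcal{C}$ of close-to-convex functions on the unit disk. (1) If $\lambda\geq\frac{9+\sqrt{33}}{12}$, then $$|\lambda a_3^2-a_5|\leq 9\lambda-5,$$ where equality holds if $f$ is the Koebe function $f(z)=z/(1-z)^2$. (2) If $\frac{6}{7}<\lambda<\frac{9+\sqrt{33}}{12}$, then $$|\lambda a_3^2-a_5|\leq \frac{\lambda(12-7\lambda)+3(2-\lambda)\sqrt{3\lambda(2-\lambda)}}{\lambda(6-4\lambda)}.$$ (3) If $0<\lambda\leq\frac{6}{7}$, then $|\lambda a_3^2-a_5|\leq 5$.
   Context: Let $\mathbb{D}=\{z\in\mathbb{C}:|z|<1\}$. $\mathcal{S}$ is the family of univalent analytic functions in $\mathbb{D}$ of the form $f(z)=z+\sum_{k=2}^{\infty}a_kz^k$. A function $g\in\mathcal{S}$ is starlike if $g(\mathbb{D})$ is starlike with respect to the origin; $\mathcal{S}^*$ denotes the class of all starlike functions in $\mathcal{S}$. An analytic function $f$ in $\mathbb{D}$ of the form $f(z)=z+\sum_{k=2}^{\infty}a_kz^k$ is called close-to-convex if there exist a real number $\theta$ and a function $g\in\mathcal{S}^*$ such that $\mathrm{Re}\left(e^{i\theta}zf'(z)/g(z)\right)>0$ for $z\in\mathbb{D}$. $\mathcal{C}$ denotes the class of all close-to-convex functions. *)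

theory Defs
  imports "HOL-Complex_Analysis.Complex_Analysis"
begin

abbreviation unit_disc :: "complex set" where
  "unit_disc \<equiv> ball 0 1"

text \<open>\<open>f(z) = z + a\<^sub>2 z\<^sup>2 + a\<^sub>3 z\<^sup>3 + \<dots>\<close> on the unit disc;
  the values \<open>a 0\<close> and \<open>a 1\<close> are irrelevant.\<close>

definition has_normalized_series :: "(complex \<Rightarrow> complex) \<Rightarrow> (nat \<Rightarrow> complex) \<Rightarrow> bool" where
  "has_normalized_series f a \<longleftrightarrow>
     (\<forall>z\<in>unit_disc. (\<lambda>k. a (k + 2) * z ^ (k + 2)) sums (f z - z))"

definition normalized_analytic :: "(complex \<Rightarrow> complex) set" where
  "normalized_analytic =
     {f. f analytic_on unit_disc \<and> (\<exists>a. has_normalized_series f a)}"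

definition schlicht :: "(complex \<Rightarrow> complex) set" where
  "schlicht = {f \<in> normalized_analytic. inj_on f unit_disc}"

definition starlike_wrt :: "complex \<Rightarrow> complex set \<Rightarrow> bool" where
  "starlike_wrt c S \<longleftrightarrow> c \<in> S \<and> (\<forall>x\<in>S. closed_segment c x \<subseteq> S)"

definition starlike_functions :: "(complex \<Rightarrow> complex) set" where
  "starlike_functions = {g \<in> schlicht. starlike_wrt 0 (g ` unit_disc)}"

text \<open>For \<open>g\<close> in the starlike class, \<open>z f'(z) / g(z)\<close> has a removable singularity
  at \<open>0\<close>, where it takes the value \<open>f'(0) / g'(0) = 1\<close>; in HOL the bare quotient would be
  \<open>0 / 0 = 0\<close> there.\<close>

definition close_to_convex :: "(complex \<Rightarrow> complex) set" where
  "close_to_convex = {f \<in> normalized_analytic. \<exists>\<theta>::real. \<exists>g\<in>starlike_functions.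
     \<forall>z\<in>unit_disc.
       Re (exp (\<i> * of_real \<theta>) * (if z = 0 then 1 else z * deriv f z / g z)) > 0}"

definition koebe :: "complex \<Rightarrow> complex" where
  "koebe z = z / (1 - z)\<^sup>2"

end

theory Submission
  imports Defs
begin

text \<open>Write \<open>f' = p q\<^sup>2\<close> with \<open>q\<^sup>2 = g / z\<close>. Since \<open>g\<close> is starlike, \<open>Re q > 1/2\<close>, so by Caratheodory the
  first coefficients of \<open>q\<close> are averages of those of \<open>1 / (1 - y z)\<close>; likewise those of \<open>p\<close> are
  averages of those of \<open>(1 + c x z) / (1 - x z)\<close> with \<open>c = exp (- 2 \<i> \<theta>)\<close>. Merging the three linear denominators into
  averages of \<open>(1 - w z)^-3\<close> shows that \<open>(a\<^sub>3, a\<^sub>5)\<close> is an average of pairs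
  \<open>(2 A + B, 3 A\<^sup>2 + 2 A B)\<close> with \<open>\<bar>A\<bar>, \<bar>B\<bar> \<le> 1\<close>. After a rotation the functional becomes
  \<open>l (Re a\<^sub>3)\<^sup>2 - Re a\<^sub>5\<close>, which is convex, so it suffices to bound it at such a pair: with
  \<open>2 Im A Im B \<le> k (Im A)\<^sup>2 + (Im B)\<^sup>2 / k\<close> the bound \<open>3 + k + 1/k\<close> holds whenever a quadratic form in
  \<open>(Re A, Re B)\<close> is positive semidefinite, and \<open>k\<close> is chosen according to the range of \<open>l\<close>.\<close>

text \<open>The preimage of a convex set under an affine map is convex, so membership need only be
  checked on the generators. Maps affine in each argument separately are handled by two uses in
  succession.\<close>

lemma hull_affine_image:
  assumes "u \<in> convex hull S" and "convex C" and "\<And>x. x \<in> S \<Longrightarrow> T x \<in> C"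
    and "\<And>x y a b. a \<ge> 0 \<Longrightarrow> b \<ge> 0 \<Longrightarrow> a + b = 1 \<Longrightarrow>
           T (a *\<^sub>R x + b *\<^sub>R y) = a *\<^sub>R T x + b *\<^sub>R T y"
  shows "T u \<in> C"
proof -
  have "convex (T -` C)"
    using assms(2,4) by (auto intro!: convexI simp: convexD)
  then have "convex hull S \<subseteq> T -` C"
    using assms(3) by (intro hull_minimal) auto
  then show ?thesis using assms(1) by auto
qed

section \<open>Convex hulls of moment vectors\<close>

text \<open>Coefficients of \<zeta>, ..., \<zeta>^4 in the geometric series of 1 / (1 - y
  \<zeta>).\<close>

definition moments :: "complex \<Rightarrow> complex \<times> complex \<times> complex \<times> complex" where
  "moments y = (y, y ^ 2, y ^ 3, y ^ 4)"

text \<open>Weights of Boole's rule with nodes \<open>i / 4\<close>: it has nonnegative weights and is exact up to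
  degree 5, so it replaces the Feynman parameter integrals
  \<open>1 / ((1 - y z) (1 - y' z)) = \<integral> (1 - (t y + (1 - t) y') z)^-2 dt\<close> and
  \<open>1 / ((1 - x z) (1 - w z)\<^sup>2) = \<integral> 2 s (1 - ((1 - s) x + s w) z)^-3 ds\<close>
  in the first four coefficients.\<close>

definition boole :: "nat \<Rightarrow> real" where
  "boole i = [7, 32, 12, 32, 7] ! i / 90"

text \<open>If \<open>u\<close> and \<open>v\<close> hold the coefficients of \<open>z, \<dots>, z\<^sup>4\<close> in two series with constant term 1,
  these are the coefficients of the product, the \<open>n\<close>-th divided by that of \<open>1 / (1 - z)\<^sup>2\<close>.\<close>

definition sq_coeffs ::
  "complex \<times> complex \<times> complex \<times> complex \<Rightarrow> complex \<times> complex \<times> complex \<times> complex \<Rightarrow>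
   complex \<times> complex \<times> complex \<times> complex" where
  "sq_coeffs = (\<lambda>(u1,u2,u3,u4) (v1,v2,v3,v4).
     ((u1 + v1) / 2, (u2 + u1 * v1 + v2) / 3, (u3 + u2 * v1 + u1 * v2 + v3) / 4,
      (u4 + u3 * v1 + u2 * v2 + u1 * v3 + v4) / 5))"

text \<open>Entry n is the mean of \<open>w ^ n\<close> over the segment from \<open>y\<close> to
  \<open>z\<close>, which Boole's rule turns into a finite convex combination. Nodes may lie inside
  the circle, hence \<open>cball\<close> on the right.\<close>

lemma sq_coeffs_moments:
  assumes "cmod y \<le> 1" "cmod z \<le> 1"
  shows "sq_coeffs (moments y) (moments z) \<in> convex hull (moments ` cball 0 1)"
proof -
  define w where "w i = (1 - real i / 4) *\<^sub>R y + (real i / 4) *\<^sub>R z" for i :: nat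
  have w: "w i \<in> cball 0 1" if "i \<le> 4" for i
    unfolding w_def using that assms by (intro convexD[OF convex_cball]) auto
  have "(\<Sum>i\<le>4. boole i *\<^sub>R moments (w i)) \<in> convex hull (moments ` cball 0 1)"
  proof (rule convex_sum)
    show "(\<Sum>i\<le>4::nat. boole i) = 1"
      by (simp add: boole_def eval_nat_numeral)
    show "boole i \<ge> 0" if "i \<in> {..4}" for i
      using that by (auto simp: boole_def nth_Cons' )
    show "moments (w i) \<in> convex hull (moments ` cball 0 1)" if "i \<in> {..4}" for i
      using w that by (auto intro!: hull_inc)
  qed auto
  moreover have "(\<Sum>i\<le>4::nat. boole i *\<^sub>R moments (w i)) = sq_coeffs (moments y) (moments z)"
  proof -
    have [simp]: "{..4::nat} = {0,1,2,3,4}" by auto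
    show ?thesis 
    by (simp add: boole_def moments_def sq_coeffs_def w_def scaleR_conv_of_real)
      (auto simp: field_simps; (simp add: eval_nat_numeral algebra_simps))
  qed
  ultimately show ?thesis by simp
qed

lemma sq_coeffs_hull:
  assumes "u \<in> convex hull (moments ` sphere 0 1)"
  shows "sq_coeffs u u \<in> convex hull (moments ` cball 0 1)" (is "_ \<in> ?H")
proof -
  \<comment> \<open>Affine, not linear: the constant term 1 of the fixed series contributes terms
    free of the varying vector.\<close>
  have affR: "sq_coeffs u (a *\<^sub>R x + b *\<^sub>R y) = a *\<^sub>R sq_coeffs u x + b *\<^sub>R sq_coeffs u y"
    and affL: "sq_coeffs (a *\<^sub>R x + b *\<^sub>R y) u = a *\<^sub>R sq_coeffs x u + b *\<^sub>R sq_coeffs y u"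
    if "a + b = 1" for a b :: real and u x y
  proof -
    have b: "b = 1 - a" using that by simp
    show "sq_coeffs u (a *\<^sub>R x + b *\<^sub>R y) = a *\<^sub>R sq_coeffs u x + b *\<^sub>R sq_coeffs u y"
      "sq_coeffs (a *\<^sub>R x + b *\<^sub>R y) u = a *\<^sub>R sq_coeffs x u + b *\<^sub>R sq_coeffs y u"
      unfolding b
      by (cases u; cases x; cases y;
          simp add: sq_coeffs_def scaleR_conv_of_real field_simps)+
  qed
  have 1: "sq_coeffs v (moments y) \<in> ?H" if "y \<in> sphere 0 1" "v \<in> convex hull (moments ` sphere 0 1)" for y v
  proof (rule hull_affine_image[where T = "\<lambda>v. sq_coeffs v (moments y)", OF that(2)])
    fix x assume "x \<in> moments ` sphere 0 1"
    then obtain t where "x = moments t" "cmod t = 1" by force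
    then show "sq_coeffs x (moments y) \<in> ?H" using that by (simp add: sq_coeffs_moments)
  qed (auto simp: affL)
  show ?thesis
  proof (rule hull_affine_image[where T = "\<lambda>v. sq_coeffs u v", OF assms])
    fix x assume "x \<in> moments ` sphere 0 1"
    then obtain y where "x = moments y" "y \<in> sphere 0 1" by blast
    then show "sq_coeffs u x \<in> ?H" using 1[OF _ assms] by simp
  qed (auto simp: affR)
qed

text \<open>The pairs \<open>(a\<^sub>3, a\<^sub>5)\<close> of the extreme points
  \<open>(z - (x + y) / 2 z\<^sup>2) / (1 - y z)\<^sup>2\<close> have this form with \<open>A = y\<^sup>2\<close> and \<open>B = - x y\<close>.\<close>

definition zalcman_kernel :: "(complex \<times> complex) set" where
  "zalcman_kernel = (\<lambda>(A, B). (2 * A + B, 3 * A\<^sup>2 + 2 * A * B)) ` (cball 0 1 \<times> cball 0 1)"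

text \<open>The coefficients \<open>a\<^sub>3\<close> and \<open>a\<^sub>5\<close> of \<open>f\<close> when \<open>f' = p R\<close>, where \<open>p\<close> has the coefficients
  \<open>(1 + c) u\<^sub>n\<close> and \<open>R\<close> the coefficients \<open>(n + 1) v\<^sub>n\<close>.\<close>

definition ctc_coeffs ::
  "complex \<Rightarrow> complex \<times> complex \<times> complex \<times> complex \<Rightarrow> complex \<times> complex \<times> complex \<times> complex \<Rightarrow>
   complex \<times> complex" where
  "ctc_coeffs c = (\<lambda>(u1,u2,u3,u4) (v1,v2,v3,v4).
     ((3 * v2 + (1 + c) * (2 * u1 * v1 + u2)) / 3,
      (5 * v4 + (1 + c) * (4 * u1 * v3 + 3 * u2 * v2 + 2 * u3 * v1 + u4)) / 5))"

text \<open>Here f' = (1 + c x \<zeta>) / ((1 - x \<zeta>) (1 - z \<zeta>)^2). Averaging (1 - w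
  \<zeta>)^-3 over the segment from \<open>x\<close> to \<open>z\<close> with density 2 s replaces
  the three linear denominators by one cube.\<close>

lemma ctc_coeffs_moments:
  assumes "cmod x \<le> 1" "cmod z \<le> 1" "cmod c \<le> 1"
  shows "ctc_coeffs c (moments x) (moments z) \<in> convex hull zalcman_kernel"
proof -
  define w where "w i = (1 - real i / 4) *\<^sub>R x + (real i / 4) *\<^sub>R z" for i :: nat
  \<comment> \<open>The coefficient pair for f' = (1 + c x \<zeta>) (1 - w \<zeta>)^-3: a kernel
    point with A = w^2 and B = c x w.\<close>
  define k where "k w = (2 * w\<^sup>2 + c * x * w, 3 * (w\<^sup>2)\<^sup>2 + 2 * w\<^sup>2 * (c * x * w))" for w
  have w: "cmod (w i) \<le> 1" if "i \<le> 4" for i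
    using convexD[OF convex_cball, of x 0 1 z "1 - real i / 4" "real i / 4"] that assms
    by (auto simp: w_def)
  have k: "k v \<in> zalcman_kernel" if "cmod v \<le> 1" for v
  proof -
    have "cmod (v\<^sup>2) \<le> 1" "cmod (c * x * v) \<le> 1"
      using that assms by (simp_all add: norm_power norm_mult power_le_one mult_le_one)
    then show ?thesis
      unfolding zalcman_kernel_def k_def
      by (intro image_eqI[where x = "(v\<^sup>2, c * x * v)"]) auto
  qed
  \<comment> \<open>The factor \<open>real i / 2\<close> is the density 2 s at s = i / 4. With it
    the integrand has degree at most 5 in s, still within the exactness of Boole's rule.\<close>
  have "(\<Sum>i\<le>4. (boole i * real i / 2) *\<^sub>R k (w i)) \<in> convex hull zalcman_kernel"
  proof (rule convex_sum)
    show "(\<Sum>i\<le>4::nat. boole i * real i / 2) = 1"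
      by (simp add: boole_def eval_nat_numeral)
    show "boole i * real i / 2 \<ge> 0" if "i \<in> {..4}" for i
      using that by (auto simp: boole_def nth_Cons' )
    show "k (w i) \<in> convex hull zalcman_kernel" if "i \<in> {..4}" for i
      using w k that by (auto intro!: hull_inc)
  qed auto
  moreover have "(\<Sum>i\<le>4::nat. (boole i * real i / 2) *\<^sub>R k (w i)) = ctc_coeffs c (moments x) (moments z)"
  proof -
    have [simp]: "{..4::nat} = {0,1,2,3,4}" by auto
    show ?thesis 
    by (simp add: boole_def moments_def ctc_coeffs_def k_def w_def scaleR_conv_of_real)
      (auto simp: field_simps; (simp add: eval_nat_numeral algebra_simps))
  qed
  ultimately show ?thesis by simp
qed

text \<open>Affine in \<open>u\<close> and in \<open>v\<close> separately, so both may be replaced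
  by generators.\<close>

lemma ctc_coeffs_hull:
  assumes "u \<in> convex hull (moments ` sphere 0 1)" "v \<in> convex hull (moments ` cball 0 1)"
    and c: "cmod c \<le> 1"
  shows "ctc_coeffs c u v \<in> convex hull zalcman_kernel"
proof -
  have affR: "ctc_coeffs c u (a *\<^sub>R x + b *\<^sub>R y) = a *\<^sub>R ctc_coeffs c u x + b *\<^sub>R ctc_coeffs c u y"
    and affL: "ctc_coeffs c (a *\<^sub>R x + b *\<^sub>R y) u = a *\<^sub>R ctc_coeffs c x u + b *\<^sub>R ctc_coeffs c y u"
    if "a + b = 1" for a b :: real and u x y
  proof -
    have b: "b = 1 - a" using that by simp
    show "ctc_coeffs c u (a *\<^sub>R x + b *\<^sub>R y) = a *\<^sub>R ctc_coeffs c u x + b *\<^sub>R ctc_coeffs c u y"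
      "ctc_coeffs c (a *\<^sub>R x + b *\<^sub>R y) u = a *\<^sub>R ctc_coeffs c x u + b *\<^sub>R ctc_coeffs c y u"
      unfolding b
      by (cases u; cases x; cases y;
          simp add: ctc_coeffs_def scaleR_conv_of_real field_simps)+
  qed
  have 1: "ctc_coeffs c u (moments z) \<in> convex hull zalcman_kernel" if "z \<in> cball 0 1" for z
  proof (rule hull_affine_image[where T = "\<lambda>v. ctc_coeffs c v (moments z)", OF assms(1)])
    fix x assume "x \<in> moments ` sphere 0 1"
    then obtain t where "x = moments t" "cmod t = 1" by force
    then show "ctc_coeffs c x (moments z) \<in> convex hull zalcman_kernel"
      using that c by (simp add: ctc_coeffs_moments)
  qed (auto simp: affL)
  show ?thesis
  proof (rule hull_affine_image[where T = "\<lambda>v. ctc_coeffs c u v", OF assms(2)])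
    fix x assume "x \<in> moments ` cball 0 1"
    then obtain z where "x = moments z" "z \<in> cball 0 1" by blast
    then show "ctc_coeffs c u x \<in> convex hull zalcman_kernel" using 1 by simp
  qed (auto simp: affR)
qed

section \<open>The Zalcman functional on the hull\<close>

text \<open>After the imaginary parts are eliminated, what is subtracted from
  \<open>3 + k + 1 / k\<close> is a quadratic form in the real parts with diagonal
  \<open>6 + k - 4 * l\<close>, \<open>1 / k - l\<close> and off-diagonal entry
  \<open>1 - 2 * l\<close>. The last two hypotheses make it positive semidefinite.\<close>

lemma zalcman_kernel_bound:
  fixes A B :: complex and l k :: real
  assumes "cmod A \<le> 1" "cmod B \<le> 1" "k > 0" "6 + k - 4 * l > 0"
    and "(6 + k - 4 * l) * (1 / k - l) \<ge> (2 * l - 1)\<^sup>2"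
  shows "l * (Re (2 * A + B))\<^sup>2 - Re (3 * A\<^sup>2 + 2 * A * B) \<le> 3 + k + 1 / k"
proof -
  define a b s t where ab: "a = Re A" "b = Re B" "s = Im A" "t = Im B"
  have 1: "a\<^sup>2 + s\<^sup>2 \<le> 1" "b\<^sup>2 + t\<^sup>2 \<le> 1"
    using assms(1,2) power_le_one[of "cmod A" 2] power_le_one[of "cmod B" 2]
    by (simp_all add: ab cmod_power2)
  define \<alpha> \<beta> where "\<alpha> = 6 + k - 4 * l" and "\<beta> = 1 / k - l"
  have "\<alpha> * (\<alpha> * a\<^sup>2 + \<beta> * b\<^sup>2 + 2 * (1 - 2 * l) * a * b)
      = (\<alpha> * a + (1 - 2 * l) * b)\<^sup>2 + (\<alpha> * \<beta> - (2 * l - 1)\<^sup>2) * b\<^sup>2"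
    by (simp add: power2_eq_square algebra_simps)
  moreover have "(\<alpha> * \<beta> - (2 * l - 1)\<^sup>2) * b\<^sup>2 \<ge> 0"
    using assms(5) by (simp add: \<alpha>_def \<beta>_def)
  ultimately have "\<alpha> * (\<alpha> * a\<^sup>2 + \<beta> * b\<^sup>2 + 2 * (1 - 2 * l) * a * b) \<ge> 0"
    by simp
  then have Q: "\<alpha> * a\<^sup>2 + \<beta> * b\<^sup>2 + 2 * (1 - 2 * l) * a * b \<ge> 0"
    using assms(4) by (simp add: \<alpha>_def zero_le_mult_iff)
  have "k * s\<^sup>2 + t\<^sup>2 / k - 2 * s * t = (k * s - t)\<^sup>2 / k"
    using \<open>k > 0\<close> by (simp add: power2_eq_square field_simps)
  also have "\<dots> \<ge> 0" using \<open>k > 0\<close> by simp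
  finally have "2 * s * t \<le> k * s\<^sup>2 + t\<^sup>2 / k" by simp
  also have "\<dots> \<le> k * (1 - a\<^sup>2) + (1 - b\<^sup>2) / k"
    using 1 \<open>k > 0\<close> by (intro add_mono mult_left_mono divide_right_mono) auto
  finally have st: "2 * s * t \<le> k * (1 - a\<^sup>2) + (1 - b\<^sup>2) / k" .
  have "l * (2 * a + b)\<^sup>2 - (3 * (a\<^sup>2 - s\<^sup>2) + 2 * (a * b - s * t)) \<le> 3 + k + 1 / k"
    using Q st 1 by (simp add: \<alpha>_def \<beta>_def power2_eq_square algebra_simps diff_divide_distrib)
  then show ?thesis
    by (simp add: ab power2_eq_square algebra_simps)
qed

text \<open>Multiplying \<open>A\<close> and \<open>B\<close> by a unimodular \<eta> preserves the
  kernel and multiplies the functional by \<eta>^2, so its value can be made real and nonnegative.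
  Replacing the real part of the square by the square of the real part only increases it and leaves
  a convex function, bounded on the hull by its bound on the kernel.\<close>

lemma zalcman_hull_bound:
  fixes l k :: real
  assumes "(c, d) \<in> convex hull zalcman_kernel" and "l \<ge> 0" "k > 0" "6 + k - 4 * l > 0"
    and "(6 + k - 4 * l) * (1 / k - l) \<ge> (2 * l - 1)\<^sup>2"
  shows "cmod (of_real l * c\<^sup>2 - d) \<le> 3 + k + 1 / k"
proof -
  define w where "w = of_real l * c\<^sup>2 - d"
  obtain \<eta> where \<eta>: "cmod \<eta> = 1" "\<eta>\<^sup>2 * w = of_real (cmod w)"
  proof (cases "w = 0")
    case True
    then show ?thesis using that[of 1] by simp
  next
    case False
    show ?thesis
    proof (rule that[of "csqrt (cnj (sgn w))"])
      show "cmod (csqrt (cnj (sgn w))) = 1"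
        using False by (simp add: norm_sgn)
      have "cnj w * w = of_real ((cmod w)\<^sup>2)"
        by (simp only: complex_norm_square mult.commute)
      then show "(csqrt (cnj (sgn w)))\<^sup>2 * w = of_real (cmod w)"
        using False by (simp add: sgn_eq power2_eq_square[of "cmod w"])
    qed
  qed
  define J where "J = (\<lambda>(c, d). l * (Re (\<eta> * c))\<^sup>2 - Re (\<eta>\<^sup>2 * d))"
  have "convex_on (convex hull zalcman_kernel) J"
  proof (rule convex_onI)
    fix t :: real and x y :: "complex \<times> complex" assume t: "0 < t" "t < 1"
    obtain x1 x2 y1 y2 where xy: "x = (x1, x2)" "y = (y1, y2)" by fastforce
    define X Y where "X = Re (\<eta> * x1)" and "Y = Re (\<eta> * y1)"
    have "(1 - t) * J x + t * J y - J ((1 - t) *\<^sub>R x + t *\<^sub>R y)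
        = l * ((1 - t) * X\<^sup>2 + t * Y\<^sup>2 - ((1 - t) * X + t * Y)\<^sup>2)"
      by (simp add: J_def xy X_def Y_def scaleR_conv_of_real algebra_simps)
    also have "\<dots> = l * (t * (1 - t) * (X - Y)\<^sup>2)"
      by (simp add: power2_eq_square algebra_simps)
    also have "\<dots> \<ge> 0" using t \<open>l \<ge> 0\<close> by simp
    finally show "J ((1 - t) *\<^sub>R x + t *\<^sub>R y) \<le> (1 - t) * J x + t * J y" by simp
  qed simp
  moreover have "\<forall>x\<in>zalcman_kernel. J x \<le> 3 + k + 1 / k"
  proof
    fix x assume "x \<in> zalcman_kernel"
    then obtain A B where AB: "cmod A \<le> 1" "cmod B \<le> 1" "x = (2 * A + B, 3 * A\<^sup>2 + 2 * A * B)"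
      by (auto simp: zalcman_kernel_def)
    have "l * (Re (2 * (\<eta> * A) + \<eta> * B))\<^sup>2 - Re (3 * (\<eta> * A)\<^sup>2 + 2 * (\<eta> * A) * (\<eta> * B)) \<le> 3 + k + 1 / k"
      using AB \<eta> assms by (intro zalcman_kernel_bound) (auto simp: norm_mult)
    then show "J x \<le> 3 + k + 1 / k"
      by (simp add: J_def AB(3) power2_eq_square algebra_simps)
  qed
  ultimately have J: "J (c, d) \<le> 3 + k + 1 / k"
    using convex_on_convex_hull_bound assms(1) by blast
  have "cmod w = Re (\<eta>\<^sup>2 * w)" using \<eta> by simp
  also have "\<dots> = l * Re ((\<eta> * c)\<^sup>2) - Re (\<eta>\<^sup>2 * d)"
    by (simp add: w_def power_mult_distrib algebra_simps)
  also have "\<dots> \<le> l * (Re (\<eta> * c))\<^sup>2 - Re (\<eta>\<^sup>2 * d)"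
    using \<open>l \<ge> 0\<close> by (intro diff_right_mono mult_left_mono) (auto simp: power2_eq_square)
  finally show ?thesis using J by (simp add: J_def w_def)
qed

lemma zalcman_hull_norm:
  assumes "(c, d) \<in> convex hull zalcman_kernel"
  shows "cmod c \<le> 3"
proof -
  have "fst (c, d) \<in> cball 0 3"
  proof (rule hull_affine_image[OF assms])
    show "fst x \<in> cball 0 3" if x: "x \<in> zalcman_kernel" for x :: "complex \<times> complex"
    proof -
      obtain p where p: "x = (\<lambda>(A, B). (2 * A + B, 3 * A\<^sup>2 + 2 * A * B)) p"
          "p \<in> cball 0 1 \<times> cball 0 1"
        using x unfolding zalcman_kernel_def by (rule imageE)
      then have "fst x = 2 * fst p + snd p" by (simp add: case_prod_unfold)
      with p(2) show ?thesis
        using norm_triangle_ineq[of "2 * fst p" "snd p"] by (simp add: norm_mult mem_Times_iff)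
    qed
  qed auto
  then show ?thesis by simp
qed

text \<open>Each range has its own \<open>k\<close>: to keep \<open>3 + k + 1 / k\<close> small it
  should be as near 1 as semidefiniteness allows.\<close>

lemma zalcman_bounds:
  assumes H: "(c, d) \<in> convex hull zalcman_kernel" and "l > 0"
  shows "l \<ge> (9 + sqrt 33) / 12 \<Longrightarrow> cmod (of_real l * c\<^sup>2 - d) \<le> 9 * l - 5"
    and "6 / 7 < l \<Longrightarrow> l < (9 + sqrt 33) / 12 \<Longrightarrow> cmod (of_real l * c\<^sup>2 - d)
              \<le> (l * (12 - 7 * l) + 3 * (2 - l) * sqrt (3 * l * (2 - l))) / (l * (6 - 4 * l))"
    and "l \<le> 6 / 7 \<Longrightarrow> cmod (of_real l * c\<^sup>2 - d) \<le> 5"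
proof -
  have s: "sqrt 33 > 5" "sqrt 33 < 6"
    by (simp_all add: real_less_rsqrt real_less_lsqrt)
  {
    assume l: "l \<ge> (9 + sqrt 33) / 12"
    \<comment> \<open>At the threshold \<open>k = 6 * m - 7\<close> makes the form vanish at (1, 1),
      that is at \<open>A = B = 1\<close>, which yields the Koebe pair (3, 5). Larger
      \<open>l\<close> follow by the triangle inequality: the slope 9 is the square of the bound 3
      on \<open>cmod c\<close>.\<close>
    define m where "m = (9 + sqrt 33) / 12"
    have m: "7 / 6 < m" "m < 5 / 4" using s by (simp_all add: m_def)
    have "6 * m\<^sup>2 - 9 * m + 2 = 0" by (simp add: m_def power2_eq_square algebra_simps)
    then have k: "1 / (6 * m - 7) = 3 * m - 1"
      using m by (simp add: field_simps power2_eq_square)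
    have "cmod (of_real m * c\<^sup>2 - d) \<le> 3 + (6 * m - 7) + 1 / (6 * m - 7)"
    proof (rule zalcman_hull_bound[OF H])
      have "(6 + (6 * m - 7) - 4 * m) * (3 * m - 1 - m) = (2 * m - 1)\<^sup>2"
        by (simp add: power2_eq_square algebra_simps)
      then show "(2 * m - 1)\<^sup>2 \<le> (6 + (6 * m - 7) - 4 * m) * (1 / (6 * m - 7) - m)"
        unfolding k by simp
    qed (use m in auto)
    then have 1: "cmod (of_real m * c\<^sup>2 - d) \<le> 9 * m - 5"
      by (simp add: k)
    have "cmod (of_real (l - m) * c\<^sup>2) = (l - m) * (cmod c)\<^sup>2"
      using l by (simp add: norm_mult norm_power m_def flip: of_real_diff)
    also have "\<dots> \<le> (l - m) * 3\<^sup>2"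
      using l zalcman_hull_norm[OF H] by (intro mult_left_mono power_mono) (auto simp: m_def)
    finally have 2: "cmod (of_real (l - m) * c\<^sup>2) \<le> (l - m) * 9" by simp
    have "of_real l * c\<^sup>2 - d = (of_real m * c\<^sup>2 - d) + of_real (l - m) * c\<^sup>2"
      by (simp add: algebra_simps)
    then show "cmod (of_real l * c\<^sup>2 - d) \<le> 9 * l - 5"
      using norm_triangle_ineq[of "of_real m * c\<^sup>2 - d" "of_real (l - m) * c\<^sup>2"] 1 2
      by (simp add: algebra_simps)
  }
  {
    assume l: "6 / 7 < l" "l < (9 + sqrt 33) / 12"
    then have l2: "l < 5 / 4" using s by simp
    \<comment> \<open>With \<open>k = r - 1\<close> the determinant condition becomes an equality:
      it reads \<open>l * (k + 1)^2 \<le> 6 - 3 * l\<close>.\<close>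
    define r where "r = sqrt (3 * (2 - l) / l)"
    have r2: "l * r\<^sup>2 = 6 - 3 * l" using l l2 by (simp add: r_def field_simps)
    have r1: "r > 1" unfolding r_def using l l2 by (simp add: field_simps)
    have "sqrt (3 * l * (2 - l)) = sqrt (l\<^sup>2 * (3 * (2 - l) / l))"
      using \<open>l > 0\<close> by (simp add: power2_eq_square)
    also have "\<dots> = l * r" unfolding r_def real_sqrt_mult using \<open>l > 0\<close> by simp
    finally have lr: "sqrt (3 * l * (2 - l)) = l * r" .
    have "(6 + (r - 1) - 4 * l) * (1 / (r - 1) - l) - (2 * l - 1)\<^sup>2
        = (6 - 3 * l - l * r\<^sup>2) / (r - 1)"
      using r1 by (simp add: field_simps power2_eq_square)
    then have "cmod (of_real l * c\<^sup>2 - d) \<le> 3 + (r - 1) + 1 / (r - 1)"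
      using r1 r2 l2 \<open>l > 0\<close> by (intro zalcman_hull_bound[OF H]) auto
    also have "1 / (r - 1) = l * (r + 1) / (6 - 4 * l)"
    proof -
      have "l * (r + 1) * (r - 1) = 6 - 4 * l"
        using r2 by (simp add: power2_eq_square algebra_simps)
      then show ?thesis using r1 l2 by (simp add: field_simps)
    qed
    also have "3 + (r - 1) + l * (r + 1) / (6 - 4 * l)
        = (l * (12 - 7 * l) + 3 * (2 - l) * (l * r)) / (l * (6 - 4 * l))"
      using l2 \<open>l > 0\<close> by (simp add: field_simps)
    finally show "cmod (of_real l * c\<^sup>2 - d)
              \<le> (l * (12 - 7 * l) + 3 * (2 - l) * sqrt (3 * l * (2 - l))) / (l * (6 - 4 * l))"
      by (simp only: lr)
  }
  {
    \<comment> \<open>The minimum of \<open>k + 1 / k\<close> is at \<open>k = 1\<close>, where the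
      determinant condition is exactly \<open>7 * l \<le> 6\<close>.\<close>
    assume "l \<le> 6 / 7"
    then have "cmod (of_real l * c\<^sup>2 - d) \<le> 3 + 1 + 1 / 1"
      using \<open>l > 0\<close> by (intro zalcman_hull_bound[OF H]) (auto simp: power2_eq_square algebra_simps)
    then show "cmod (of_real l * c\<^sup>2 - d) \<le> 5" by simp
  }
qed

section \<open>Functions with positive real part\<close>

lemma compact_moments_hull: "compact (convex hull (moments ` sphere 0 1))"
  unfolding moments_def
  by (intro compact_convex_hull compact_continuous_image continuous_intros) auto

text \<open>Cauchy's formula for \<open>k = 0\<close> and Cauchy's theorem for \<open>k > 0\<close>.
  The differential on the circle supplies one factor u, so the contour integrand carries the power
  \<open>k - 1\<close>.\<close>

lemma circle_integral_power_nonneg: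
  assumes q: "q holomorphic_on ball 0 1" and R: "0 < R" "R < 1"
  shows "((\<lambda>t. q (of_real R * exp (2 * of_real pi * \<i> * of_real t)) * exp (2 * of_real pi * \<i> * of_real t) ^ k)
           has_integral (if k = 0 then q 0 else 0)) {0..1}"
  supply cp = fun_cong[OF circlepath[of 0 R]]
proof (cases k)
  case 0
  have "((\<lambda>u. q u / (u - 0)) has_contour_integral 2 * of_real pi * \<i> * q 0) (circlepath 0 R)"
    using R by (intro Cauchy_integral_circlepath continuous_on_subset[OF holomorphic_on_imp_continuous_on[OF q]]
        holomorphic_on_subset[OF q]) auto
  then have "((\<lambda>t. 2 * of_real pi * \<i> * q (of_real R * exp (2 * of_real pi * \<i> * of_real t)))
               has_integral 2 * of_real pi * \<i> * q 0) {0..1}"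
    unfolding has_contour_integral_def
    by (rule has_integral_eq[rotated]) (use R in \<open>simp add: vector_derivative_circlepath01 cp\<close>)
  from has_integral_mult_right[OF this, of "1 / (2 * of_real pi * \<i>)"]
  show ?thesis by (simp add: 0)
next
  case (Suc m)
  have "((\<lambda>u. q u * u ^ m) has_contour_integral 0) (circlepath 0 R)"
    using R by (intro Cauchy_theorem_disc_simple[where a = 0 and e = 1] holomorphic_intros q) auto
  then have "((\<lambda>t. 2 * of_real pi * \<i> * of_real R ^ k *
                 (q (of_real R * exp (2 * of_real pi * \<i> * of_real t)) * exp (2 * of_real pi * \<i> * of_real t) ^ k))
               has_integral 0) {0..1}"
    unfolding has_contour_integral_def
    by (rule has_integral_eq[rotated])
      (use R in \<open>simp add: vector_derivative_circlepath01 cp Suc power_mult_distrib\<close>)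
  from has_integral_mult_right[OF this, of "1 / (2 * of_real pi * \<i> * of_real R ^ k)"] R
  show ?thesis by (simp add: Suc)
qed

text \<open>Cauchy's formula for the \<open>k\<close>-th derivative at 0; the factor u from the
  differential lowers the exponent \<open>Suc k\<close> to \<open>k\<close>.\<close>

lemma circle_integral_power_neg:
  assumes q: "q holomorphic_on ball 0 1" "q has_fps_expansion F" and R: "0 < R" "R < 1"
  shows "((\<lambda>t. q (of_real R * exp (2 * of_real pi * \<i> * of_real t)) / exp (2 * of_real pi * \<i> * of_real t) ^ k)
           has_integral (fps_nth F k * of_real R ^ k)) {0..1}"
  supply cp = fun_cong[OF circlepath[of 0 R]]
proof -
  have "((\<lambda>u. q u / (u - 0) ^ Suc k) has_contour_integral (2 * of_real pi * \<i>) / fact k * (deriv ^^ k) q 0)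
          (circlepath 0 R)"
  proof -
    have "continuous_on (cball 0 R) q" "q holomorphic_on ball 0 R"
      using R by (auto intro!: continuous_on_subset[OF holomorphic_on_imp_continuous_on[OF q(1)]]
          holomorphic_on_subset[OF q(1)])
    from Cauchy_has_contour_integral_higher_derivative_circlepath[OF this, of 0 k]
    show ?thesis using R by (simp add: algebra_simps)
  qed
  also have "(2 * of_real pi * \<i>) / fact k * (deriv ^^ k) q 0 = 2 * of_real pi * \<i> * fps_nth F k"
    using fps_nth_fps_expansion[OF q(2), of k] by simp
  finally have "((\<lambda>t. 2 * of_real pi * \<i> / of_real R ^ k *
                 (q (of_real R * exp (2 * of_real pi * \<i> * of_real t)) / exp (2 * of_real pi * \<i> * of_real t) ^ k))
               has_integral 2 * of_real pi * \<i> * fps_nth F k) {0..1}"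
    unfolding has_contour_integral_def
    by (rule has_integral_eq[rotated])
      (use R in \<open>simp add: vector_derivative_circlepath01 cp power_mult_distrib\<close>)
  from has_integral_mult_right[OF this, of "of_real R ^ k / (2 * of_real pi * \<i>)"] R
  show ?thesis by (simp add: mult.commute)
qed

text \<open>Integrate \<open>q\<close> on the circle of radius \<open>R\<close> against the
  nonnegative trigonometric polynomial \<open>T\<close>. Only its negative powers and its constant
  meet nonzero Fourier coefficients of \<open>q\<close>; the halves come from writing a real part as
  half the sum with the conjugate.\<close>

lemma caratheodory_pairing:
  fixes a :: "nat \<Rightarrow> complex"
  assumes q: "q holomorphic_on ball 0 1" "q has_fps_expansion F" "q 0 = 1"
    and pos: "\<And>z. z \<in> ball 0 1 \<Longrightarrow> Re (q z) > 0"
    and b: "\<And>y. cmod y = 1 \<Longrightarrow> (\<Sum>k=1..n. Re (a k * y ^ k)) \<ge> b"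
  shows "(\<Sum>k=1..n. Re (a k * fps_nth F k / 2)) \<ge> b"
proof -
  have *: "(\<Sum>k=1..n. Re (a k * fps_nth F k / 2) * R ^ k) - b \<ge> 0" if R: "0 < R" "R < 1" for R :: real
  proof -
    define e where "e t = exp (2 * of_real pi * \<i> * of_real t)" for t :: real
    have e: "cmod (e t) = 1" for t by (simp add: e_def)
    then have ce: "cnj (e t) = 1 / e t" for t
      using complex_norm_square[of "e t"] e[of t] by (metis nonzero_eq_divide_eq mult.commute norm_zero
          of_real_1 one_power2 zero_neq_one)
    define T where "T t = (\<Sum>k=1..n. Re (a k / e t ^ k)) - b" for t
    have T: "T t \<ge> 0" for t
      using b[of "cnj (e t)"] e by (simp add: T_def ce power_divide norm_divide)
    have T_eq: "of_real (T t) = (\<Sum>k=1..n. a k / 2 / e t ^ k + cnj (a k) / 2 * e t ^ k) - of_real b" for t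
    proof -
      have "of_real (Re z) = z / 2 + cnj z / 2" for z
        by (simp add: complex_add_cnj flip: add_divide_distrib)
      moreover have "cnj (a k / e t ^ k) = cnj (a k) * e t ^ k" for k
        by (simp add: ce power_divide)
      ultimately have "of_real (Re (a k / e t ^ k)) = a k / 2 / e t ^ k + cnj (a k) / 2 * e t ^ k" for k
        by (simp add: field_simps)
      then show ?thesis by (simp add: T_def)
    qed
    have I: "((\<lambda>t. (\<Sum>k=1..n. a k / 2 * (q (R * e t) / e t ^ k) + cnj (a k) / 2 * (q (R * e t) * e t ^ k))
                  - of_real b * (q (R * e t) * e t ^ 0))
           has_integral ((\<Sum>k=1..n. a k / 2 * (fps_nth F k * of_real R ^ k) + cnj (a k) / 2 * (if k = 0 then q 0 else 0))
                  - of_real b * (if (0::nat) = 0 then q 0 else 0))) {0..1}"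
      unfolding e_def
      by (intro has_integral_diff has_integral_sum has_integral_add has_integral_mult_right
          circle_integral_power_nonneg[OF q(1) R] circle_integral_power_neg[OF q(1,2) R]) auto
    have "((\<lambda>t. q (R * e t) * of_real (T t)) has_integral
            ((\<Sum>k=1..n. a k / 2 * (fps_nth F k * of_real R ^ k)) - of_real b)) {0..1}"
      using I by (rule has_integral_eq_rhs[OF has_integral_eq[rotated]])
        (auto simp: T_eq q(3) algebra_simps sum_distrib_left)
    then have "((\<lambda>t. Re (q (R * e t) * of_real (T t))) has_integral
            Re ((\<Sum>k=1..n. a k / 2 * (fps_nth F k * of_real R ^ k)) - of_real b)) {0..1}"
      by (rule has_integral_Re)
    moreover have "Re (q (R * e t) * of_real (T t)) \<ge> 0" for t
      using pos[of "R * e t"] T[of t] R e by (auto simp: norm_mult)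
    ultimately have "Re ((\<Sum>k=1..n. a k / 2 * (fps_nth F k * of_real R ^ k)) - of_real b) \<ge> 0"
      by (rule has_integral_nonneg) 
    then show ?thesis
      by (simp add: algebra_simps flip: of_real_power)
  qed
  \<comment> \<open>The integrals live on circles inside the disc; the resulting polynomial
    inequality in \<open>R\<close> passes to the limit 1.\<close>
  have "((\<lambda>R. (\<Sum>k=1..n. Re (a k * fps_nth F k / 2) * R ^ k) - b) \<longlongrightarrow>
         (\<Sum>k=1..n. Re (a k * fps_nth F k / 2) * 1 ^ k) - b) (at_left 1)"
    by (intro tendsto_intros)
  moreover have "eventually (\<lambda>R::real. (\<Sum>k=1..n. Re (a k * fps_nth F k / 2) * R ^ k) - b \<ge> 0) (at_left 1)"
    using eventually_at_left_real[of 0 "1::real", simplified] by eventually_elim (use * in auto)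
  ultimately have "(\<Sum>k=1..n. Re (a k * fps_nth F k / 2) * 1 ^ k) - b \<ge> 0"
    by (intro tendsto_lowerbound) auto
  then show ?thesis by simp
qed

text \<open>The hull is compact, so a point outside it is strictly separated by a real linear
  functional, contradicting the pairing inequality.\<close>

lemma caratheodory_moments:
  assumes q: "q holomorphic_on ball 0 1" "q has_fps_expansion F" "q 0 = 1"
    and pos: "\<And>z. z \<in> ball 0 1 \<Longrightarrow> Re (q z) > 0"
  shows "(fps_nth F 1 / 2, fps_nth F 2 / 2, fps_nth F 3 / 2, fps_nth F 4 / 2)
           \<in> convex hull (moments ` sphere 0 1)" (is "?u \<in> ?H")
proof (rule ccontr)
  assume "?u \<notin> ?H"
  then obtain a b where ab: "inner a ?u < b" "\<forall>x\<in>?H. inner a x > b"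
    using separating_hyperplane_closed_point[of ?H ?u] compact_imp_closed[OF compact_moments_hull] by auto
  obtain a1 a2 a3 a4 where a: "a = (a1, a2, a3, a4)" by (metis prod.exhaust)
  \<comment> \<open>Conjugates turn the real inner product into \<open>Re (A k * w)\<close>; the
    leading 0 aligns list positions with powers of \<open>y\<close>.\<close>
  define A where "A k = cnj ([0, a1, a2, a3, a4] ! k)" for k :: nat
  have in_eq: "inner (v::complex) w = Re (cnj v * w)" for v w
    by (simp add: inner_complex_def)
  have A: "(\<Sum>k=1..4. Re (A k * g k)) = inner a (g 1, g 2, g 3, g 4)" for g
    by (simp add: A_def a in_eq eval_nat_numeral)
  have "(\<Sum>k=1..4. Re (A k * fps_nth F k / 2)) \<ge> b"
  proof (rule caratheodory_pairing[OF q pos])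
    fix y :: complex assume "cmod y = 1"
    then have "moments y \<in> ?H" by (intro hull_inc) auto
    then show "(\<Sum>k=1..4. Re (A k * y ^ k)) \<ge> b"
      using ab(2) A[of "\<lambda>k. y ^ k"] by (auto simp: moments_def less_imp_le)
  qed
  then show False using ab(1) A[of "\<lambda>k. fps_nth F k / 2"] by simp
qed

section \<open>Starlike functions\<close>

text \<open>One-sided Fermat criterion, for paths in the disc compared with their end point.\<close>

lemma left_max_derivative_nonneg:
  fixes f :: "real \<Rightarrow> real"
  assumes "(f has_real_derivative D) (at x)" "eventually (\<lambda>t. f t \<le> f x) (at_left x)"
  shows "D \<ge> 0"
proof (rule ccontr)
  assume "\<not> D \<ge> 0"
  then obtain d where d: "d > 0" "\<And>h. h > 0 \<Longrightarrow> h < d \<Longrightarrow> f x < f (x - h)"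
    using DERIV_neg_dec_left[OF assms(1)] by auto
  have "eventually (\<lambda>t. t \<in> {x - d<..<x}) (at_left x)"
    using d(1) by (intro eventually_at_left_real) auto
  with assms(2) have "eventually (\<lambda>t. False) (at_left x)"
  proof eventually_elim
    case (elim t)
    then show ?case using d(2)[of "x - t"] by auto
  qed
  then show False by simp
qed

text \<open>With \<open>k\<close> the inverse of \<open>g\<close>, starlikeness makes
  \<open>k (t * g y)\<close> a self-map of the disc fixing 0, so Schwarz gives
  \<open>cmod (k (t * g z)) \<le> cmod z\<close>. Hence \<open>Re (cnj z * k (t * g z))\<close> is
  largest at \<open>t = 1\<close>, and its left derivative there yields the sign of the reciprocal
  quotient.\<close>

lemma starlike_Re_nonneg:
  assumes holg: "g holomorphic_on ball 0 1" and inj: "inj_on g (ball 0 1)" and g0: "g 0 = 0"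
    and star: "starlike_wrt 0 (g ` ball 0 1)" and z: "z \<in> ball 0 1" "z \<noteq> 0"
  shows "Re (z * deriv g z / g z) \<ge> 0"
proof -
  obtain k where k: "k holomorphic_on (g ` ball 0 1)"
    "\<And>z. z \<in> ball 0 1 \<Longrightarrow> deriv g z * deriv k (g z) = 1" "\<And>z. z \<in> ball 0 1 \<Longrightarrow> k (g z) = z"
    using holomorphic_has_inverse[OF holg open_ball inj] by metis
  have opn: "open (g ` ball 0 1)"
    using open_mapping_thm3[OF holg open_ball inj] .
  have tg: "of_real t * g y \<in> g ` ball 0 1" if "y \<in> ball 0 1" "0 \<le> t" "t \<le> 1" for t :: real and y
  proof -
    have "closed_segment 0 (g y) \<subseteq> g ` ball 0 1"
      using star that(1) by (auto simp: starlike_wrt_def)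
    moreover have "of_real t * g y \<in> closed_segment 0 (g y)"
      using that by (auto simp: in_segment scaleR_conv_of_real)
    ultimately show ?thesis by auto
  qed
  have schwarz: "cmod (k (of_real t * g z)) \<le> cmod z" if t: "0 < t" "t < 1" for t :: real
  proof (rule Schwarz_Lemma(1)[of "\<lambda>y. k (of_real t * g y)"])
    have "(k \<circ> (\<lambda>y. of_real t * g y)) holomorphic_on ball 0 1"
      using tg t by (intro holomorphic_on_compose_gen[OF _ k(1)] holomorphic_intros holg) auto
    then show "(\<lambda>y. k (of_real t * g y)) holomorphic_on ball 0 1" by (simp add: o_def)
    show "k (of_real t * g 0) = 0" using k(3)[of 0] g0 by simp
    show "cmod (k (of_real t * g y)) < 1" if "cmod y < 1" for y
    proof -
      from tg[of y t] t that obtain x where "x \<in> ball 0 1" "of_real t * g y = g x" by auto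
      then show ?thesis using k(3)[of x] by simp
    qed
  qed (use z in auto)
  have dk: "(k has_field_derivative deriv k (g z)) (at (g z))"
    using holomorphic_derivI[OF k(1) opn] z by auto
  have "((\<lambda>s. k (s * g z)) has_field_derivative (deriv k (g z) * g z)) (at (of_real 1))"
    by (rule DERIV_chain2[where f = k and g = "\<lambda>s. s * g z"]) (use dk in \<open>auto intro!: derivative_eq_intros\<close>)
  then have "((\<lambda>t. k (of_real t * g z)) has_vector_derivative (deriv k (g z) * g z)) (at 1)"
    using has_vector_derivative_real_field[where f = "\<lambda>s. k (s * g z)" and a = 1] by simp
  then have "((\<lambda>t. cnj z * k (of_real t * g z)) has_vector_derivative (cnj z * (deriv k (g z) * g z))) (at 1)"
    by (rule has_vector_derivative_mult_right)
  then have "((\<lambda>t. Re (cnj z * k (of_real t * g z))) has_real_derivative Re (cnj z * (deriv k (g z) * g z))) (at 1)"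
    unfolding has_real_derivative_iff_has_vector_derivative
    by (rule bounded_linear.has_vector_derivative[OF bounded_linear_Re])
  then have "Re (cnj z * (deriv k (g z) * g z)) \<ge> 0"
  proof (rule left_max_derivative_nonneg)
    show "eventually (\<lambda>t. Re (cnj z * k (of_real t * g z)) \<le> Re (cnj z * k (of_real 1 * g z))) (at_left 1)"
      using eventually_at_left_real[of 0 1, simplified]
    proof eventually_elim
      case (elim t)
      have "Re (cnj z * k (of_real t * g z)) \<le> cmod z * cmod (k (of_real t * g z))"
        using complex_Re_le_cmod[of "cnj z * k (of_real t * g z)"] by (simp add: norm_mult)
      also have "\<dots> \<le> cmod z * cmod z"
        using schwarz elim by (intro mult_left_mono) auto
      also have "\<dots> = Re (cnj z * k (of_real 1 * g z))"
        using k(3)[OF z(1)] by (simp add: cmod_power2 flip: power2_eq_square) 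
      finally show ?case .
    qed
  qed
  moreover have gz: "g z \<noteq> 0"
    using inj_onD[OF inj, of z 0] z g0 by auto
  moreover have "deriv k (g z) = 1 / deriv g z"
    using k(2)[OF z(1)] by (metis nonzero_eq_divide_eq mult.commute mult_zero_left zero_neq_one)
  ultimately have "Re (cnj z * g z / deriv g z) \<ge> 0" by simp
  then have *: "Re (cnj z * g z / deriv g z) \<ge> 0" .
  define W where "W = inverse (z * deriv g z / g z)"
  have "cnj z * g z / deriv g z = of_real ((cmod z)\<^sup>2) * W"
    unfolding W_def using z by (simp only: complex_norm_square) (simp add: field_simps)
  with * have "(cmod z)\<^sup>2 * Re W \<ge> 0" by (simp del: of_real_power)
  then have "Re (inverse (z * deriv g z / g z)) \<ge> 0" using z by (simp add: zero_le_mult_iff W_def)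
  then show ?thesis
    by (subst (asm) inverse_complex.simps) (auto simp: zero_le_divide_iff sum_power2_le_zero_iff)
qed

text \<open>By the open mapping theorem a nonconstant image lies in the interior of the closed
  half-plane; a constant takes its value at \<open>x\<close>.\<close>

lemma holomorphic_Re_pos:
  assumes "p holomorphic_on S" "open S" "connected S" "x \<in> S" "Re (p x) > 0"
    and "\<And>z. z \<in> S \<Longrightarrow> Re (p z) \<ge> 0" and "z \<in> S"
  shows "Re (p z) > 0"
proof (cases "p constant_on S")
  case True
  then show ?thesis using assms by (auto simp: constant_on_def)
next
  case False
  then have "open (p ` S)"
    using open_mapping_thm[OF assms(1,2,3,2)] by auto
  moreover have "p ` S \<subseteq> {w. Re w \<ge> 0}" using assms(6) by auto
  ultimately have "p ` S \<subseteq> interior {w. Re w \<ge> 0}" by (rule interior_maximal[rotated])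
  moreover have "interior {w. Re w \<ge> 0} = {w. Re w > 0}"
    using interior_halfspace_ge[of "1::complex" 0] by (simp add: inner_complex_def)
  ultimately show ?thesis using assms(7) by auto
qed

text \<open>A variant of Jack's lemma: at a point of least modulus where \<open>\<omega> = 1 - 1 / q\<close> reaches the
  unit circle, Schwarz' lemma bounds the derivative of \<open>\<omega>\<close> in every inward direction
  \<open>- \<eta> z\<^sub>0\<close>; the choice \<open>\<eta> = - 2 e / (1 - e)\<close> with \<open>e = \<omega> z\<^sub>0\<close> gives the contradiction.\<close>

lemma Re_gt_half:
  assumes q: "q holomorphic_on ball 0 1" "q 0 = 1" and q0: "\<And>z. z \<in> ball 0 1 \<Longrightarrow> q z \<noteq> 0"
    and pos: "\<And>z. z \<in> ball 0 1 \<Longrightarrow> Re (1 + 2 * z * deriv q z / q z) > 0"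
    and z: "z \<in> ball 0 1"
  shows "Re (q z) > 1 / 2"
proof -
  \<comment> \<open>The claim amounts to \<open>cmod (q z - 1) < cmod (q z)\<close>, that is
    \<open>cmod (\<omega> z) < 1\<close>.\<close>
  define \<omega> where "\<omega> z = 1 - 1 / q z" for z
  have hol\<omega>: "\<omega> holomorphic_on ball 0 1"
    unfolding \<omega>_def using q0 by (intro holomorphic_intros q) auto
  have "cmod (\<omega> z) < 1"
  proof (rule ccontr)
    assume "\<not> cmod (\<omega> z) < 1"
    define K where "K = {x \<in> cball 0 (cmod z). cmod (\<omega> x) \<ge> 1}"
    have sub: "cball 0 (cmod z) \<subseteq> ball 0 1" using z by auto
    have "continuous_on (cball 0 (cmod z)) (\<lambda>x. cmod (\<omega> x))"
      by (intro continuous_intros continuous_on_subset[OF holomorphic_on_imp_continuous_on[OF hol\<omega>] sub])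
    then have "closed K"
      unfolding K_def by (intro continuous_on_closed_Collect_le continuous_on_const) auto
    moreover have "bounded K"
      by (rule bounded_subset[OF bounded_cball[of 0 "cmod z"]]) (auto simp: K_def)
    ultimately have "compact K" by (simp add: compact_eq_bounded_closed)
    moreover have "K \<noteq> {}" using \<open>\<not> cmod (\<omega> z) < 1\<close> by (auto simp: K_def)
    ultimately obtain z0 where z0: "z0 \<in> K" "\<And>y. y \<in> K \<Longrightarrow> cmod z0 \<le> cmod y"
      using continuous_attains_inf[of K cmod] continuous_on_norm_id by blast
    have z0b: "z0 \<in> ball 0 1" using z0(1) z by (auto simp: K_def)
    have z0n: "z0 \<noteq> 0" using z0(1) q by (auto simp: K_def \<omega>_def)
    have less: "cmod (\<omega> y) < 1" if "cmod y < cmod z0" for y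
      using z0(2)[of y] z0(1) that by (force simp: K_def)
    have schwarz: "cmod (\<omega> (z0 * y)) \<le> cmod y" if "cmod y < 1" for y
    proof (rule Schwarz_Lemma(1)[of "\<lambda>y. \<omega> (z0 * y)"])
      have small: "cmod (z0 * y) < cmod z0" if "cmod y < 1" for y
        using z0n that by (simp add: norm_mult)
      have "(\<omega> \<circ> (\<lambda>y. z0 * y)) holomorphic_on ball 0 1"
        using small z0b by (intro holomorphic_on_compose_gen[OF _ hol\<omega>] holomorphic_intros) fastforce+
      then show "(\<lambda>y. \<omega> (z0 * y)) holomorphic_on ball 0 1" by (simp add: o_def)
      show "cmod (\<omega> (z0 * y)) < 1" if "cmod y < 1" for y using less small that by blast
      show "\<omega> (z0 * 0) = 0" using q by (simp add: \<omega>_def)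
    qed fact
    define e where "e = \<omega> z0"
    have d\<omega>: "(\<omega> has_field_derivative deriv \<omega> z0) (at z0)"
      using holomorphic_derivI[OF hol\<omega>] z0b by auto
    have e1: "cmod e = 1"
    proof (rule antisym)
      show "cmod e \<ge> 1" using z0(1) by (simp add: K_def e_def)
      have "((\<lambda>t. cmod (\<omega> (of_real t * z0))) \<longlongrightarrow> cmod (\<omega> (of_real 1 * z0))) (at_left 1)"
      proof (intro tendsto_norm isCont_tendsto_compose[of "of_real 1 * z0" \<omega>])
        show "isCont \<omega> (of_real 1 * z0)" using d\<omega> DERIV_isCont by auto
      qed (intro tendsto_intros)
      moreover have "eventually (\<lambda>t. cmod (\<omega> (of_real t * z0)) \<le> 1) (at_left (1::real))"
        using eventually_at_left_real[of 0 1, simplified]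
        by eventually_elim (use z0n in \<open>auto intro!: less_imp_le less simp: norm_mult\<close>)
      ultimately show "cmod e \<le> 1"
        unfolding e_def by (intro tendsto_upperbound[of "\<lambda>t. cmod (\<omega> (of_real t * z0))"]) auto
    qed
    have ne: "e \<noteq> 1" using q0[OF z0b] by (simp add: e_def \<omega>_def)
    define \<eta> where "\<eta> = - 2 * e / (1 - e)"
    have Re\<eta>: "Re \<eta> = 1"
    proof -
      have "\<eta> + cnj \<eta> = 2"
      proof -
        have "e * cnj e = 1" using complex_norm_square[of e] e1 by simp
        moreover have "e \<noteq> 0" using e1 by auto
        ultimately have "cnj e = 1 / e" by (simp add: field_simps)
        moreover have "1 - 1 / e = (e - 1) / e" using \<open>e \<noteq> 0\<close> by (simp add: field_simps)
        ultimately have "cnj \<eta> = - 2 / (e - 1)" using \<open>e \<noteq> 0\<close> by (simp add: \<eta>_def)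
        moreover have "\<eta> = 2 * e / (e - 1)" using ne by (simp add: \<eta>_def divide_simps algebra_simps)
        ultimately have "\<eta> + cnj \<eta> = 2 * e / (e - 1) + - 2 / (e - 1)" by (simp only:)
        also have "\<dots> = (2 * e - 2) / (e - 1)" by (simp add: diff_divide_distrib)
        also have "\<dots> = 2" using ne by (simp add: field_simps)
        finally show ?thesis .
      qed
      then show ?thesis by (simp add: complex_add_cnj complex_eq_iff)
    qed
    \<comment> \<open>The bound \<open>cmod x\<close> from Schwarz is replaced by the larger
      \<open>(1 + (cmod x)^2) / 2\<close>, which agrees with it at \<open>t = 1\<close> and is
      polynomial in \<open>t\<close>. Since \<open>Re \<eta> = 1\<close>, its derivative there is
      1.\<close>
    define D where "D t = Re (cnj e * \<omega> (z0 * (1 - (1 - of_real t) * \<eta>)))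
        - (1 + (cmod (1 - (1 - of_real t) * \<eta>))\<^sup>2) / 2" for t :: real
    have D1: "D 1 = 0"
      using e1 by (simp add: D_def e_def[symmetric] cmod_power2[symmetric] mult.commute[of "cnj e"]
            complex_mult_cnj)
    have "((\<lambda>s. \<omega> (z0 * (1 - (1 - s) * \<eta>))) has_field_derivative (deriv \<omega> z0 * (z0 * \<eta>))) (at (of_real 1))"
      by (rule DERIV_chain2[where f = \<omega> and g = "\<lambda>s. z0 * (1 - (1 - s) * \<eta>)"])
        (use d\<omega> in \<open>auto intro!: derivative_eq_intros\<close>)
    then have "((\<lambda>t. \<omega> (z0 * (1 - (1 - of_real t) * \<eta>))) has_vector_derivative (deriv \<omega> z0 * (z0 * \<eta>))) (at 1)"
      using has_vector_derivative_real_field[where f = "\<lambda>s. \<omega> (z0 * (1 - (1 - s) * \<eta>))" and a = 1] by simp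
    then have "((\<lambda>t. cnj e * \<omega> (z0 * (1 - (1 - of_real t) * \<eta>))) has_vector_derivative (cnj e * (deriv \<omega> z0 * (z0 * \<eta>)))) (at 1)"
      by (rule has_vector_derivative_mult_right)
    then have d1: "((\<lambda>t. Re (cnj e * \<omega> (z0 * (1 - (1 - of_real t) * \<eta>)))) has_real_derivative
        Re (cnj e * (deriv \<omega> z0 * (z0 * \<eta>)))) (at 1)"
      unfolding has_real_derivative_iff_has_vector_derivative
      by (rule bounded_linear.has_vector_derivative[OF bounded_linear_Re])
    have norm_eq: "(cmod (1 - (1 - of_real t) * \<eta>))\<^sup>2 = 1 - 2 * (1 - t) + (1 - t)\<^sup>2 * (cmod \<eta>)\<^sup>2" for t :: real
      unfolding cmod_power2 by (simp add: Re\<eta> power2_eq_square algebra_simps)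
    have "(D has_real_derivative (Re (cnj e * (deriv \<omega> z0 * (z0 * \<eta>))) - 1)) (at 1)"
      unfolding D_def norm_eq by (rule derivative_eq_intros d1 refl | simp)+
    then have "Re (cnj e * (deriv \<omega> z0 * (z0 * \<eta>))) - 1 \<ge> 0"
    proof (rule left_max_derivative_nonneg)
      have \<eta>0: "\<eta> \<noteq> 0" using Re\<eta> by auto
      have "eventually (\<lambda>t. t \<in> {1 - 1 / (cmod \<eta>)\<^sup>2<..<1}) (at_left 1)"
        using \<eta>0 by (intro eventually_at_left_real) auto
      then show "eventually (\<lambda>t. D t \<le> D 1) (at_left 1)"
      proof eventually_elim
        case (elim t)
        define x where "x = 1 - (1 - of_real t) * \<eta>"
        have "(1 - t) * (cmod \<eta>)\<^sup>2 < 1" using elim \<eta>0 by (simp add: field_simps)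
        then have "(1 - t) * ((1 - t) * (cmod \<eta>)\<^sup>2) < (1 - t) * 1"
          using elim by (intro mult_strict_left_mono) auto
        then have "(1 - t)\<^sup>2 * (cmod \<eta>)\<^sup>2 < 1 - t"
          by (simp only: power2_eq_square[of "1 - t"] mult.assoc mult_1_right)
        moreover have "1 - 2 * (1 - t) + X < 1" if "X < 1 - t" for X
          using elim that by simp
        ultimately have "(cmod x)\<^sup>2 < 1"
          unfolding x_def norm_eq by blast
        then have "cmod x < 1" by (simp add: power_less_one_iff abs_square_less_1)
        have "Re (cnj e * \<omega> (z0 * x)) \<le> cmod (\<omega> (z0 * x))"
          using complex_Re_le_cmod[of "cnj e * \<omega> (z0 * x)"] e1 by (simp add: norm_mult)
        also have "\<dots> \<le> cmod x" using schwarz \<open>cmod x < 1\<close> by blast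
        also have "\<dots> \<le> (1 + (cmod x)\<^sup>2) / 2"
          using zero_le_power2[of "cmod x - 1"] by (simp add: power2_eq_square algebra_simps)
        finally show ?case by (simp only: D1) (simp add: D_def x_def)
      qed
    qed
    moreover have "deriv \<omega> z0 = deriv q z0 / (q z0)\<^sup>2"
    proof -
      have "(q has_field_derivative deriv q z0) (at z0)"
        using holomorphic_derivI[OF q(1)] z0b by auto
      then have "(\<omega> has_field_derivative deriv q z0 / (q z0)\<^sup>2) (at z0)"
        unfolding \<omega>_def using q0[OF z0b]
        by (auto intro!: derivative_eq_intros simp: power2_eq_square)
      then show ?thesis by (rule DERIV_imp_deriv)
    qed
    moreover have "1 - e = 1 / q z0" by (simp add: e_def \<omega>_def)
    moreover have "cnj e * e = 1" using complex_norm_square[of e] e1 by (simp add: mult.commute)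
    \<comment> \<open>Because \<open>1 - e = 1 / q z0\<close>, the direction is
      \<open>\<eta> = - 2 * e * q z0\<close>, which turns the derivative inequality into one for the
      logarithmic derivative of \<open>q\<close>, against \<open>pos\<close>.\<close>
    ultimately have "Re (- (2 * z0 * deriv q z0 / q z0)) \<ge> 1"
    proof -
      have "cnj e * (deriv \<omega> z0 * (z0 * \<eta>)) = (cnj e * e) * (- (2 * z0 * deriv q z0 / q z0))"
        unfolding \<eta>_def \<open>1 - e = 1 / q z0\<close> \<open>deriv \<omega> z0 = deriv q z0 / (q z0)\<^sup>2\<close>
        using q0[OF z0b] by (simp add: power2_eq_square field_simps)
      then show ?thesis
        using \<open>cnj e * e = 1\<close> \<open>Re (cnj e * (deriv \<omega> z0 * (z0 * \<eta>))) - 1 \<ge> 0\<close> by simp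
    qed
    then show False using pos[OF z0b] by simp
  qed
  then have "cmod (q z - 1) < cmod (q z)"
    using q0[OF z] by (simp add: \<omega>_def diff_divide_eq_iff norm_divide)
  then have "(cmod (q z - 1))\<^sup>2 < (cmod (q z))\<^sup>2" by (simp add: power_strict_mono)
  then show ?thesis unfolding cmod_power2 by (simp add: power2_eq_square algebra_simps)
qed

section \<open>Normalized series and the Koebe function\<close>

lemma normalized_series_sums:
  assumes "has_normalized_series f a" "z \<in> unit_disc"
  shows "(\<lambda>k. (if k = 0 then 0 else if k = 1 then 1 else a k) * z ^ k) sums f z"
proof -
  have "(\<lambda>k. (if k + 2 = 0 then 0 else if k + 2 = 1 then 1 else a (k + 2)) * z ^ (k + 2)) sums (f z - z)"
    using assms by (simp add: has_normalized_series_def)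
  from sums_iff_shift[THEN iffD1, OF this[unfolded]] show ?thesis
    by (simp add: lessThan_Suc eval_nat_numeral)
qed

lemma normalized_series_fps:
  assumes "has_normalized_series f a"
  shows "f has_fps_expansion Abs_fps (\<lambda>k. if k = 0 then 0 else if k = 1 then 1 else a k)"
proof (rule has_fps_expansionI)
  have "eventually (\<lambda>z. z \<in> unit_disc) (nhds (0::complex))"
    by (intro eventually_nhds_in_open) auto
  then show "eventually (\<lambda>z. (\<lambda>k. fps_nth (Abs_fps (\<lambda>k. if k = 0 then 0 else if k = 1 then 1 else a k)) k * z ^ k)
      sums f z) (nhds 0)"
    by eventually_elim (use normalized_series_sums[OF assms] in simp)
qed

lemma normalized_analyticD:
  assumes "f \<in> normalized_analytic"
  shows "f holomorphic_on unit_disc" "f 0 = 0" "deriv f 0 = 1"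
proof -
  show "f holomorphic_on unit_disc"
    using assms by (simp add: normalized_analytic_def analytic_on_open)
  obtain a where "has_normalized_series f a" using assms by (auto simp: normalized_analytic_def)
  note * = normalized_series_fps[OF this]
  show "f 0 = 0" using has_fps_expansion_imp_0_eq_fps_nth_0[OF *] by simp
  show "deriv f 0 = 1" using fps_nth_fps_expansion[OF *, of 1] by simp
qed

section \<open>The Koebe function: series, slit image, univalence and starlikeness\<close>

lemma koebe_series: "has_normalized_series koebe of_nat"
  unfolding has_normalized_series_def
proof
  fix z :: complex assume z: "z \<in> unit_disc"
  have "(\<lambda>n. z * (of_nat (Suc n) * z ^ n)) sums (z * (1 / (1 - z)\<^sup>2))"
    using z by (intro sums_mult geometric_deriv_sums) auto
  then have "(\<lambda>n. of_nat (Suc n) * z ^ Suc n) sums koebe z"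
    by (simp add: koebe_def mult_ac)
  then have "(\<lambda>n. of_nat (Suc (Suc n)) * z ^ Suc (Suc n)) sums (koebe z - z)"
    by (subst sums_Suc_iff) simp
  then show "(\<lambda>k. of_nat (k + 2) * z ^ (k + 2)) sums (koebe z - z)"
    by (simp add: mult_ac)
qed

text \<open>With \<open>\<zeta> = (1 + z) / (1 - z)\<close>, which maps the disc onto the right half-plane,
  the Koebe function is \<open>(\<zeta>\<^sup>2 - 1) / 4\<close>.\<close>

lemma koebe_cayley:
  assumes "z \<noteq> 1"
  shows "1 + 4 * koebe z = ((1 + z) / (1 - z))\<^sup>2"
proof -
  have "(1 - z)\<^sup>2 \<noteq> 0" using assms by simp
  then have "1 + 4 * koebe z = ((1 - z)\<^sup>2 + 4 * z) / (1 - z)\<^sup>2"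
    by (simp add: koebe_def add_divide_distrib)
  also have "(1 - z)\<^sup>2 + 4 * z = (1 + z)\<^sup>2"
    by (simp add: power2_eq_square algebra_simps)
  finally show ?thesis by (simp add: power_divide)
qed

lemma Re_cayley_pos:
  assumes "z \<in> unit_disc"
  shows "Re ((1 + z) / (1 - z)) > 0"
proof -
  have "cmod z < 1" using assms by simp
  then have "(cmod z)\<^sup>2 < 1" by (simp add: power_less_one_iff)
  moreover have "1 - z \<noteq> 0" using assms by auto
  moreover have "Re ((1 + z) / (1 - z)) = (1 - (cmod z)\<^sup>2) / (cmod (1 - z))\<^sup>2"
    unfolding Re_divide cmod_power2 by (simp add: power2_eq_square algebra_simps)
  ultimately show ?thesis by simp
qed

text \<open>The plane slit from -1/4 to minus infinity: squaring maps the right half-plane onto the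
  plane without the nonpositive reals. The principal square root and the inverse Cayley map give
  preimages.\<close>

lemma koebe_image:
  "w \<in> koebe ` unit_disc \<longleftrightarrow> 1 + 4 * w \<notin> \<real>\<^sub>\<le>\<^sub>0"
proof
  assume "w \<in> koebe ` unit_disc"
  then obtain z where z: "z \<in> unit_disc" "w = koebe z" by auto
  define \<zeta> where "\<zeta> = (1 + z) / (1 - z)"
  have pos: "Re \<zeta> > 0" using Re_cayley_pos[OF z(1)] by (simp add: \<zeta>_def)
  moreover have "1 + 4 * w = \<zeta>\<^sup>2" using z by (subst z(2), subst koebe_cayley) (auto simp: \<zeta>_def)
  ultimately show "1 + 4 * w \<notin> \<real>\<^sub>\<le>\<^sub>0"
    using pos by (auto simp: complex_nonpos_Reals_iff power2_eq_square mult_le_0_iff)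
next
  assume w: "1 + 4 * w \<notin> \<real>\<^sub>\<le>\<^sub>0"
  define \<zeta> where "\<zeta> = csqrt (1 + 4 * w)"
  have sq: "\<zeta>\<^sup>2 = 1 + 4 * w" by (simp add: \<zeta>_def)
  have "Re \<zeta> \<ge> 0" using csqrt_principal[of "1 + 4 * w"] by (auto simp: \<zeta>_def)
  moreover have "Re \<zeta> \<noteq> 0"
  proof
    assume "Re \<zeta> = 0"
    then have "\<zeta>\<^sup>2 \<in> \<real>\<^sub>\<le>\<^sub>0" by (simp add: complex_nonpos_Reals_iff power2_eq_square)
    then show False using w sq by simp
  qed
  ultimately have pos: "Re \<zeta> > 0" by simp
  then have n: "\<zeta> + 1 \<noteq> 0" by (auto simp: complex_eq_iff)
  define z where "z = (\<zeta> - 1) / (\<zeta> + 1)"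
  have "(cmod (\<zeta> - 1))\<^sup>2 < (cmod (\<zeta> + 1))\<^sup>2"
    using pos unfolding cmod_power2 by (simp add: power2_eq_square algebra_simps)
  then have "cmod (\<zeta> - 1) < cmod (\<zeta> + 1)" by (rule power_less_imp_less_base) simp
  then have z: "z \<in> unit_disc" using n by (simp add: z_def norm_divide)
  have "1 - z = 2 / (\<zeta> + 1)" using n by (simp add: z_def field_simps)
  then have "koebe z = (\<zeta> - 1) / (\<zeta> + 1) / (2 / (\<zeta> + 1))\<^sup>2"
    by (simp add: koebe_def z_def)
  also have "x / N / (2 / N)\<^sup>2 = x * N / 4" if "N \<noteq> 0" for x N :: complex
    using that by (simp add: field_simps power2_eq_square)
  then have "(\<zeta> - 1) / (\<zeta> + 1) / (2 / (\<zeta> + 1))\<^sup>2 = (\<zeta> - 1) * (\<zeta> + 1) / 4"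
    using n by blast
  also have "\<dots> = (\<zeta>\<^sup>2 - 1) / 4"
    by (simp add: power2_eq_square algebra_simps)
  finally have "koebe z = w" by (simp add: sq)
  with z show "w \<in> koebe ` unit_disc" by blast
qed

text \<open>Squaring is injective on the right half-plane, and the Cayley map is injective.\<close>

lemma koebe_inj: "inj_on koebe unit_disc"
proof (rule inj_onI)
  fix x y assume xy: "x \<in> unit_disc" "y \<in> unit_disc" "koebe x = koebe y"
  have ne: "x \<noteq> 1" "y \<noteq> 1" using xy by auto
  have "((1 + x) / (1 - x))\<^sup>2 = ((1 + y) / (1 - y))\<^sup>2"
    using koebe_cayley[OF ne(1)] koebe_cayley[OF ne(2)] xy(3) by simp
  moreover have "(1 + x) / (1 - x) \<noteq> - ((1 + y) / (1 - y))"
  proof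
    assume "(1 + x) / (1 - x) = - ((1 + y) / (1 - y))"
    then have "Re ((1 + x) / (1 - x)) = - Re ((1 + y) / (1 - y))" by (simp only: uminus_complex.sel)
    then show False using Re_cayley_pos[OF xy(1)] Re_cayley_pos[OF xy(2)] by linarith
  qed
  ultimately have "(1 + x) / (1 - x) = (1 + y) / (1 - y)" by (simp add: power2_eq_iff)
  then show "x = y" using ne by (simp add: field_simps)
qed

text \<open>The omitted slit lies on a ray from the origin, so shrinking a point of the image
  towards 0 cannot enter it.\<close>

lemma koebe_starlike: "koebe \<in> starlike_functions"
proof -
  have "koebe holomorphic_on unit_disc"
    unfolding koebe_def by (intro holomorphic_intros) auto
  then have "koebe \<in> normalized_analytic"
    using koebe_series by (auto simp: normalized_analytic_def analytic_on_open)
  moreover have "starlike_wrt 0 (koebe ` unit_disc)"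
    unfolding starlike_wrt_def
  proof (intro conjI ballI subsetI)
    show "0 \<in> koebe ` unit_disc" by (simp add: koebe_image complex_nonpos_Reals_iff)
    fix w v assume w: "w \<in> koebe ` unit_disc" and "v \<in> closed_segment 0 w"
    then obtain t where t: "0 \<le> t" "t \<le> 1" "v = of_real t * w"
      by (auto simp: in_segment scaleR_conv_of_real)
    show "v \<in> koebe ` unit_disc"
      unfolding koebe_image
    proof
      assume "1 + 4 * v \<in> \<real>\<^sub>\<le>\<^sub>0"
      then have v: "t * Im w = 0" "1 + 4 * (t * Re w) \<le> 0"
        by (auto simp: complex_nonpos_Reals_iff t)
      then have "t \<noteq> 0" by auto
      with v have "Im w = 0" by simp
      moreover have "1 + 4 * Re w \<le> 0"
      proof -
        have "Re w \<le> 0" using v t by (smt (verit) mult_nonneg_nonneg)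
        then have "Re w \<le> t * Re w" using t mult_right_mono_neg[of t 1 "Re w"] by simp
        then show ?thesis using v by simp
      qed
      ultimately show False using w by (simp add: koebe_image complex_nonpos_Reals_iff)
    qed
  qed
  ultimately show ?thesis
    using koebe_inj by (simp add: starlike_functions_def schlicht_def)
qed

text \<open>Take \<theta> = 0 and \<open>g = koebe\<close>: the quotient is the Cayley map.\<close>

lemma koebe_close_to_convex: "koebe \<in> close_to_convex"
proof -
  have "Re (exp (\<i> * of_real 0) * (if z = 0 then 1 else z * deriv koebe z / koebe z)) > 0"
    if z: "z \<in> unit_disc" for z
  proof (cases "z = 0")
    case False
    have ne: "1 - z \<noteq> 0" using z by auto
    have "(koebe has_field_derivative (1 * (1 - z)\<^sup>2 - z * (- 2 * (1 - z))) / ((1 - z)\<^sup>2 * (1 - z)\<^sup>2)) (at z)"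
      unfolding koebe_def using ne
      by (intro DERIV_divide) (auto intro!: derivative_eq_intros)
    also have "1 * (1 - z)\<^sup>2 - z * (- 2 * (1 - z)) = (1 + z) * (1 - z)"
      by (simp add: power2_eq_square algebra_simps)
    also have "(1 + z) * (1 - z) / ((1 - z)\<^sup>2 * (1 - z)\<^sup>2) = (1 + z) / (1 - z) ^ 3"
      using ne by (simp add: power2_eq_square power3_eq_cube)
    finally have "(koebe has_field_derivative (1 + z) / (1 - z) ^ 3) (at z)" .
    then have "deriv koebe z = (1 + z) / (1 - z) ^ 3" by (rule DERIV_imp_deriv)
    then have "z * deriv koebe z / koebe z = (1 + z) / (1 - z)"
      using False ne by (simp add: koebe_def power2_eq_square power3_eq_cube)
    then show ?thesis using Re_cayley_pos[OF z] False by simp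
  qed simp
  then show ?thesis
    using koebe_starlike unfolding close_to_convex_def
    by (intro CollectI conjI exI[of _ 0] bexI[of _ koebe] ballI)
      (auto simp: starlike_functions_def schlicht_def)
qed

section \<open>Close-to-convex functions\<close>

text \<open>The quotient g / z has no zeros by univalence, hence a holomorphic square root
  \<open>q\<close>, and z g' / g = 1 + 2 z q' / q is the quantity required by
  \<open>Re_gt_half\<close>.\<close>

lemma starlike_sqrt:
  assumes "g \<in> starlike_functions"
  obtains q where "q holomorphic_on unit_disc" "q 0 = 1"
    "\<And>z. z \<in> unit_disc \<Longrightarrow> Re (q z) > 1 / 2" "\<And>z. z \<in> unit_disc \<Longrightarrow> g z = z * (q z)\<^sup>2"
proof -
  have g: "g \<in> normalized_analytic" and inj: "inj_on g unit_disc" and star: "starlike_wrt 0 (g ` unit_disc)"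
    using assms by (auto simp: starlike_functions_def schlicht_def)
  note hol = normalized_analyticD(1)[OF g] and g0 = normalized_analyticD(2)[OF g]
    and g1 = normalized_analyticD(3)[OF g]
  define G where "G z = (if z = 0 then deriv g 0 else (g z - g 0) / (z - 0))" for z
  have "G holomorphic_on unit_disc"
    unfolding G_def by (intro pole_lemma hol) auto
  moreover have G0: "G z \<noteq> 0" if "z \<in> unit_disc" for z
    using inj_onD[OF inj, of z 0] that g0 g1 by (auto simp: G_def)
  ultimately obtain s where s: "s holomorphic_on unit_disc" "\<And>z. z \<in> unit_disc \<Longrightarrow> G z = (s z)\<^sup>2"
    using contractible_imp_holomorphic_sqrt[of G unit_disc, OF _ convex_imp_contractible[OF convex_ball]]
    by blast
  have s0: "(s 0)\<^sup>2 = 1" using s(2)[of 0] g1 by (simp add: G_def)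
  \<comment> \<open>Division by \<open>s 0\<close>, whose square is 1, selects the branch with value
    1 at 0.\<close>
  define q where "q z = s z / s 0" for z
  have q: "q holomorphic_on unit_disc" "q 0 = 1"
    using s(1) s0 unfolding q_def by (auto intro!: holomorphic_intros)
  have q2: "(q z)\<^sup>2 = G z" if "z \<in> unit_disc" for z
    using s(2)[OF that] s0 by (simp add: q_def power_divide)
  have gq: "g z = z * (q z)\<^sup>2" if "z \<in> unit_disc" for z
    using q2[OF that] g0 by (simp add: G_def)
  have q0: "q z \<noteq> 0" if "z \<in> unit_disc" for z
    using q2[OF that] G0[OF that] by auto
  define p where "p z = 1 + 2 * z * deriv q z / q z" for z
  have hol_p: "p holomorphic_on unit_disc"
    unfolding p_def using q0 by (intro holomorphic_intros q holomorphic_deriv) auto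
  have p_nonneg: "Re (p z) \<ge> 0" if z: "z \<in> unit_disc" for z
  proof (cases "z = 0")
    case False
    have "(q has_field_derivative deriv q z) (at z)"
      using holomorphic_derivI[OF q(1)] z by auto
    then have "((\<lambda>z. z * (q z)\<^sup>2) has_field_derivative ((q z)\<^sup>2 + 2 * z * q z * deriv q z)) (at z)"
      by (auto intro!: derivative_eq_intros simp: algebra_simps)
    then have "(g has_field_derivative ((q z)\<^sup>2 + 2 * z * q z * deriv q z)) (at z)"
      by (rule has_field_derivative_transform_within_open[where S = unit_disc]) (use z gq in auto)
    then have "deriv g z = (q z)\<^sup>2 + 2 * z * q z * deriv q z" by (rule DERIV_imp_deriv)
    then have "z * deriv g z / g z = p z"
      using gq[OF z] q0[OF z] False by (simp add: p_def field_simps power2_eq_square)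
    then show ?thesis using starlike_Re_nonneg[OF hol inj g0 star z False] by simp
  qed (simp add: p_def)
  \<comment> \<open>Strictness spreads from 0, where \<open>p\<close> is 1.\<close>
  have "Re (p z) > 0" if "z \<in> unit_disc" for z
    by (rule holomorphic_Re_pos[OF hol_p _ _ _ _ p_nonneg that, of 0]) (auto simp: p_def)
  then have "Re (q z) > 1 / 2" if "z \<in> unit_disc" for z
    by (intro Re_gt_half[OF q q0 _ that]) (auto simp: p_def)
  then show ?thesis by (rule that[OF q _ gq])
qed

lemma close_to_convex_decomposition:
  assumes "f \<in> close_to_convex"
  obtains \<theta> :: real and p q where "p holomorphic_on unit_disc" "p 0 = 1"
    "\<And>z. z \<in> unit_disc \<Longrightarrow> Re (exp (\<i> * of_real \<theta>) * p z) > 0"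
    "q holomorphic_on unit_disc" "q 0 = 1" "\<And>z. z \<in> unit_disc \<Longrightarrow> Re (q z) > 1 / 2"
    "\<And>z. z \<in> unit_disc \<Longrightarrow> deriv f z = p z * (q z)\<^sup>2"
proof -
  obtain \<theta> :: real and g where f: "f \<in> normalized_analytic" and g: "g \<in> starlike_functions" and
    \<theta>: "\<And>z. z \<in> unit_disc \<Longrightarrow> Re (exp (\<i> * of_real \<theta>) * (if z = 0 then 1 else z * deriv f z / g z)) > 0"
    using assms unfolding close_to_convex_def by blast
  obtain q where q: "q holomorphic_on unit_disc" "q 0 = 1"
    "\<And>z. z \<in> unit_disc \<Longrightarrow> Re (q z) > 1 / 2" "\<And>z. z \<in> unit_disc \<Longrightarrow> g z = z * (q z)\<^sup>2"
    by (rule starlike_sqrt[OF g]) (rule that; assumption)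
  have q0: "q z \<noteq> 0" if "z \<in> unit_disc" for z
    using q(3)[OF that] by auto
  define p where "p z = deriv f z / (q z)\<^sup>2" for z
  have p: "p holomorphic_on unit_disc" "p 0 = 1"
    using normalized_analyticD[OF f] q0 q(1,2) unfolding p_def
    by (auto intro!: holomorphic_intros holomorphic_deriv)
  have "(if z = 0 then 1 else z * deriv f z / g z) = p z" if "z \<in> unit_disc" for z
    using q(4)[OF that] p(2) by (auto simp: p_def)
  then have p_pos: "Re (exp (\<i> * of_real \<theta>) * p z) > 0" if "z \<in> unit_disc" for z
    using \<theta>[OF that] that by simp
  have f_eq: "deriv f z = p z * (q z)\<^sup>2" if "z \<in> unit_disc" for z
    using q0[OF that] by (simp add: p_def)
  show ?thesis
    by (rule that[where \<theta> = \<theta> and p = p and q = q]; fact p p_pos q f_eq)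
qed

lemma close_to_convex_coeffs:
  assumes f: "f \<in> close_to_convex" and a: "has_normalized_series f a"
  shows "(a 3, a 5) \<in> convex hull zalcman_kernel"
proof -
  obtain \<theta> :: real and p q :: "complex \<Rightarrow> complex" where p: "p holomorphic_on unit_disc" "p 0 = 1"
    and p_pos: "\<And>z. z \<in> unit_disc \<Longrightarrow> Re (exp (\<i> * of_real \<theta>) * p z) > 0"
    and q: "q holomorphic_on unit_disc" "q 0 = 1" "\<And>z. z \<in> unit_disc \<Longrightarrow> Re (q z) > 1 / 2"
    and fpq: "\<And>z. z \<in> unit_disc \<Longrightarrow> deriv f z = p z * (q z)\<^sup>2"
    by (rule close_to_convex_decomposition[OF f]) (rule that; assumption)
  define e where "e = exp (\<i> * of_real \<theta>)"
  have e: "e \<noteq> 0" "Re e = cos \<theta>" "cmod e = 1" "e = of_real (cos \<theta>) + \<i> * of_real (sin \<theta>)"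
    by (simp add: e_def, simp_all add: e_def Re_exp complex_eq_iff Im_exp)
  have cos: "cos \<theta> > 0" using p_pos[of 0] p(2) by (simp add: e(2) flip: e_def)
  \<comment> \<open>Subtracting the imaginary part of \<open>e\<close> and dividing by its real part
    normalizes \<open>P 0 = 1\<close> and keeps the real part positive.\<close>
  define P where "P z = (e * p z - \<i> * of_real (sin \<theta>)) / of_real (cos \<theta>)" for z
  define Q where "Q z = 2 * q z - 1" for z
  have holP: "P holomorphic_on unit_disc" and holQ: "Q holomorphic_on unit_disc"
    unfolding P_def Q_def using cos by (auto intro!: holomorphic_intros p q)
  define Pf where "Pf = fps_expansion P 0"
  define Qf where "Qf = fps_expansion Q 0"
  have Pf: "P has_fps_expansion Pf" and Qf: "Q has_fps_expansion Qf"
    unfolding Pf_def Qf_def by (rule has_fps_expansion_fps_expansion[OF open_ball]; use holP holQ in simp)+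
  have P0: "P 0 = 1" using cos p(2) by (simp add: P_def e(4))
  have P_pos: "Re (P z) > 0" if "z \<in> unit_disc" for z
    using p_pos[OF that] cos by (simp add: P_def flip: e_def)
  have Q0: "Q 0 = 1" by (simp add: Q_def q)
  have Q_pos: "Re (Q z) > 0" if "z \<in> unit_disc" for z
    using q(3)[OF that] by (simp add: Q_def)
  define u where "u = (fps_nth Pf 1 / 2, fps_nth Pf 2 / 2, fps_nth Pf 3 / 2, fps_nth Pf 4 / 2)"
  define v where "v = (fps_nth Qf 1 / 2, fps_nth Qf 2 / 2, fps_nth Qf 3 / 2, fps_nth Qf 4 / 2)"
  have uv: "u \<in> convex hull (moments ` sphere 0 1)" "v \<in> convex hull (moments ` sphere 0 1)"
    unfolding u_def v_def
    using caratheodory_moments[OF holP Pf P0 P_pos] caratheodory_moments[OF holQ Qf Q0 Q_pos] by auto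
  \<comment> \<open>This makes \<open>1 + c = 2 * cos \<theta> / e\<close>, so the coefficients of
    \<open>p\<close> are \<open>1 + c\<close> times the halved coefficients of \<open>P\<close>, as
    \<open>ctc_coeffs\<close> expects.\<close>
  define c where "c = 1 / e\<^sup>2"
  have c: "cmod c \<le> 1" by (simp add: c_def norm_divide norm_power e(3))
  have "(ctc_coeffs c u (sq_coeffs v v)) \<in> convex hull zalcman_kernel"
    by (intro ctc_coeffs_hull sq_coeffs_hull uv c)
  moreover have "ctc_coeffs c u (sq_coeffs v v) = (a 3, a 5)"
  proof -
    define pf where "pf = fps_const (of_real (cos \<theta>) / e) * Pf + fps_const (\<i> * of_real (sin \<theta>) / e)"
    define qf where "qf = fps_const (1 / 2) * Qf + fps_const (1 / 2)"
    have "(\<lambda>z. of_real (cos \<theta>) / e * P z + \<i> * of_real (sin \<theta>) / e) has_fps_expansion pf"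
      unfolding pf_def by (intro fps_expansion_intros Pf)
    also have "(\<lambda>z. of_real (cos \<theta>) / e * P z + \<i> * of_real (sin \<theta>) / e) = p"
      using cos e(1) by (auto simp: P_def field_simps)
    finally have pf: "p has_fps_expansion pf" .
    have "(\<lambda>z. 1 / 2 * Q z + 1 / 2) has_fps_expansion qf"
      unfolding qf_def by (intro fps_expansion_intros Qf)
    also have "(\<lambda>z. 1 / 2 * Q z + 1 / 2) = q"
      by (auto simp: Q_def field_simps)
    finally have qf: "q has_fps_expansion qf" .
    have "e * cnj e = 1" using complex_norm_square[of e] e(3) by simp
    then have "cnj e = 1 / e" using e(1) by (simp add: field_simps)
    have "1 + c = (e + 1 / e) / e" using e(1) by (simp add: c_def field_simps power2_eq_square)
    also have "e + 1 / e = 2 * of_real (cos \<theta>)"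
      using complex_add_cnj[of e] by (simp add: e(2) \<open>cnj e = 1 / e\<close>)
    finally have c1: "1 + c = 2 * (of_real (cos \<theta>) / e)" by simp
    have p_nth: "fps_nth pf n = (1 + c) * (fps_nth Pf n / 2)" if "n > 0" for n
      using that by (simp add: pf_def c1)
    have q_nth: "fps_nth qf n = fps_nth Qf n / 2" if "n > 0" for n
      using that by (simp add: qf_def)
    have nth0: "fps_nth pf 0 = 1" "fps_nth qf 0 = 1"
      using has_fps_expansion_imp_0_eq_fps_nth_0[OF pf] has_fps_expansion_imp_0_eq_fps_nth_0[OF qf] p q by auto
    define Ff where "Ff = Abs_fps (\<lambda>k. if k = 0 then 0 else if k = 1 then 1 else a k)"
    have "deriv f has_fps_expansion fps_deriv Ff"
      unfolding Ff_def by (intro fps_expansion_intros normalized_series_fps a)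
    moreover have "deriv f has_fps_expansion pf * (qf * qf)"
    proof -
      have "(\<lambda>z. p z * (q z * q z)) has_fps_expansion pf * (qf * qf)"
        by (intro fps_expansion_intros pf qf)
      moreover have "eventually (\<lambda>z. z \<in> unit_disc) (nhds (0::complex))"
        by (intro eventually_nhds_in_open) auto
      then have "eventually (\<lambda>z. deriv f z = p z * (q z * q z)) (nhds 0)"
        by eventually_elim (simp add: fpq power2_eq_square)
      ultimately show ?thesis by (simp cong: has_fps_expansion_cong)
    qed
    ultimately have F: "fps_deriv Ff = pf * (qf * qf)"
      by (rule fps_expansion_unique_complex)
    have iv: "{0..1::nat} = {0, 1}" "{0..2::nat} = {0, 1, 2}" "{0..3::nat} = {0, 1, 2, 3}" "{0..4::nat} = {0, 1, 2, 3, 4}" by auto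
    define R where "R = qf * qf"
    have R0: "fps_nth R 0 = 1" by (simp add: R_def nth0)
    have R: "sq_coeffs v v = (fps_nth R 1 / 2, fps_nth R 2 / 3, fps_nth R 3 / 4, fps_nth R 4 / 5)"
      by (simp add: R_def fps_mult_nth iv nth0 q_nth v_def sq_coeffs_def)
    \<comment> \<open>Differentiation shifts indices: \<open>a 3\<close> and \<open>a 5\<close>
      appear in coefficients 2 and 4 of the derivative.\<close>
    have "3 * a 3 = fps_nth (pf * R) 2" "5 * a 5 = fps_nth (pf * R) 4"
      by (simp_all add: Ff_def R_def flip: F)
    then have "a 3 = fps_nth (pf * R) 2 / 3" "a 5 = fps_nth (pf * R) 4 / 5"
      by (simp_all add: eq_divide_eq mult.commute)
    then show ?thesis
      unfolding R by (simp add: fps_mult_nth iv nth0 R0 p_nth u_def ctc_coeffs_def algebra_simps add_divide_distrib)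
  qed
  ultimately show ?thesis by simp
qed

theorem corollary2:
  fixes l :: real and f :: "complex \<Rightarrow> complex" and a :: "nat \<Rightarrow> complex"
  assumes "l > 0"
    and "f \<in> close_to_convex"
    and "has_normalized_series f a"
  shows "(l \<ge> (9 + sqrt 33) / 12 \<longrightarrow>
            cmod (of_real l * (a 3)\<^sup>2 - a 5) \<le> 9 * l - 5 \<and>
            koebe \<in> close_to_convex \<and>
            ((\<forall>z\<in>unit_disc. f z = koebe z) \<longrightarrow>
               cmod (of_real l * (a 3)\<^sup>2 - a 5) = 9 * l - 5)) \<and>
         (6 / 7 < l \<and> l < (9 + sqrt 33) / 12 \<longrightarrow>
            cmod (of_real l * (a 3)\<^sup>2 - a 5)
              \<le> (l * (12 - 7 * l) + 3 * (2 - l) * sqrt (3 * l * (2 - l))) / (l * (6 - 4 * l))) \<and>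
         (0 < l \<and> l \<le> 6 / 7 \<longrightarrow> cmod (of_real l * (a 3)\<^sup>2 - a 5) \<le> 5)"
proof -
  note bounds = zalcman_bounds[OF close_to_convex_coeffs[OF assms(2,3)] assms(1)]
  have "cmod (of_real l * (a 3)\<^sup>2 - a 5) = 9 * l - 5"
    if l: "l \<ge> (9 + sqrt 33) / 12" and f: "\<forall>z\<in>unit_disc. f z = koebe z"
  proof -
    have "has_normalized_series f of_nat"
      using koebe_series f by (simp add: has_normalized_series_def)
    \<comment> \<open>Uniqueness of power series identifies the coefficients; these indices avoid
      the unconstrained values \<open>a 0\<close> and \<open>a 1\<close>.\<close>
    then have "a 3 = of_nat 3" "a 5 = of_nat 5"
      using fps_expansion_unique_complex[OF normalized_series_fps normalized_series_fps, OF assms(3)]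
      by (fastforce simp: fps_eq_iff dest: spec[of _ 3] spec[of _ 5])+
    then have "of_real l * (a 3)\<^sup>2 - a 5 = of_real (9 * l - 5)" by simp
    moreover have "9 * l - 5 \<ge> 0" if "s \<ge> 0" "l \<ge> (9 + s) / 12" for s
      using that by simp
    from this[OF _ l] have "9 * l - 5 \<ge> 0" by simp
    ultimately show ?thesis by (simp only: norm_of_real abs_of_nonneg)
  qed
  then show ?thesis using bounds koebe_close_to_convex by simp
qed

end
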